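(* Let $w_1, w_2\in\mathbb{N}$ be odd and let $n\geq 0$ be an integer. Then (as polynomials in $x$) $$w_1^n\sum_{l=0}^{w_1-1}(-1)^lE_n\!\left(w_2x+\frac{w_2}{w_1}l\right)=w_2^n\sum_{l=0}^{w_2-1}(-1)^lE_n\!\left(w_1x+\frac{w_1}{w_2}l\right).$$
   Context: $\mathbb{N}$ denotes the positive integers. $E_n(x)$ are the ordinary Euler polynomials, given by $\frac{2e^{xt}}{e^t+1}=\sum_{n\ge0}E_n(x)\frac{t^n}{n!}$. *)

theory Defs
  imports "HOL-Computational_Algebra.Computational_Algebra"
begin

text \<open>The Euler polynomials as genuine polynomials in \<open>x\<close>: \<open>E\<^sub>n(x)\<close> is \<open>n!\<close> times the
  coefficient of \<open>t\<^sup>n\<close> in \<open>2 e\<^sup>x\<^sup>t / (e\<^sup>t + 1)\<close>, a power series in \<open>t\<close> over the ring of polynomials in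
  \<open>x\<close>. As division of power series is only available over a field, \<open>2 / (e\<^sup>t + 1)\<close> is formed over
  the field of scalars and its coefficients are then embedded as constant polynomials.\<close>

definition fps_exp_X :: "'a::field_char_0 poly fps" where
  "fps_exp_X = Abs_fps (\<lambda>n. monom (1 / fact n) n)"

definition fps_lift_const :: "'a::field_char_0 fps \<Rightarrow> 'a poly fps" where
  "fps_lift_const f = Abs_fps (\<lambda>n. [:fps_nth f n:])"

definition euler_poly :: "nat \<Rightarrow> 'a::field_char_0 poly" where
  "euler_poly n = smult (fact n)
     (fps_nth (fps_lift_const (2 / (fps_exp 1 + 1)) * fps_exp_X) n)"

text \<open>The generating function, first over the polynomial ring (without division), then evaluated
  at a point.\<close>

lemma euler_poly_generating:
  "Abs_fps (\<lambda>n. smult (1 / fact n) (euler_poly n :: 'a::field_char_0 poly))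
     * (fps_lift_const (fps_exp 1) + 1) = 2 * fps_exp_X"
proof -
  have mult: "fps_lift_const (f * g) = fps_lift_const f * fps_lift_const g" for f g :: "'a fps"
    by (rule fps_ext) (simp add: fps_lift_const_def fps_mult_nth sum_to_poly mult.commute)
  have one: "fps_lift_const (fps_exp 1) + 1 = fps_lift_const (fps_exp 1 + 1 :: 'a fps)"
    by (rule fps_ext) (simp add: fps_lift_const_def one_pCons)
  have two: "fps_lift_const (2 :: 'a fps) = 2"
    by (rule fps_ext) (simp add: fps_lift_const_def fps_numeral_nth numeral_poly)
  have nz: "fps_nth (fps_exp 1 + 1 :: 'a fps) 0 \<noteq> 0"
    by simp
  have "2 / (fps_exp 1 + 1) * (fps_exp 1 + 1) = (2 :: 'a fps)"
    using nz by (simp add: fps_divide_unit mult.assoc inverse_mult_eq_1)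
  then have nz2: "fps_lift_const (2 / (fps_exp 1 + 1) :: 'a fps) * fps_lift_const (fps_exp 1 + 1) = 2"
    by (simp only: mult [symmetric] two)
  have gf: "Abs_fps (\<lambda>n. smult (1 / fact n) (euler_poly n :: 'a poly))
      = fps_lift_const (2 / (fps_exp 1 + 1)) * fps_exp_X"
    by (rule fps_ext) (simp add: euler_poly_def)
  have "fps_lift_const (2 / (fps_exp 1 + 1) :: 'a fps) * fps_exp_X * fps_lift_const (fps_exp 1 + 1)
      = fps_lift_const (2 / (fps_exp 1 + 1)) * fps_lift_const (fps_exp 1 + 1) * fps_exp_X"
    by (rule mult.commute [THEN trans], subst mult.assoc [symmetric],
        subst mult.commute [of "fps_lift_const (fps_exp 1 + 1)"], rule refl)
  then show ?thesis
    unfolding gf one nz2 .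
qed

lemma poly_euler_poly_generating:
  "Abs_fps (\<lambda>n. poly (euler_poly n) x / fact n) = 2 * fps_exp x / (fps_exp (1::'a::field_char_0) + 1)"
proof -
  have "2 * fps_exp x / (fps_exp 1 + 1) = 2 / (fps_exp 1 + 1) * fps_exp (x::'a)"
    by (simp add: fps_divide_unit mult_ac)
  moreover have "Abs_fps (\<lambda>n. poly (euler_poly n) x / fact n) = 2 / (fps_exp 1 + 1) * fps_exp x"
    by (rule fps_ext, simp only: fps_nth_Abs_fps euler_poly_def fps_mult_nth fps_lift_const_def
        fps_exp_X_def poly_smult poly_sum poly_mult poly_monom fps_exp_nth) simp
  ultimately show ?thesis
    by simp
qed

end

theory Submission
  imports Defs
begin

text \<open>The left-hand side is \<open>n!\<close> times the coefficient of \<open>t\<^sup>n\<close> in the power series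
  \<open>2 e\<^bsup>w\<^sub>1w\<^sub>2xt\<^esup> (e\<^bsup>w\<^sub>1w\<^sub>2t\<^esup> + 1) / ((e\<^bsup>w\<^sub>1t\<^esup> + 1) (e\<^bsup>w\<^sub>2t\<^esup> + 1))\<close>, because for odd \<open>w\<^sub>1\<close> the
  alternating geometric sum of the powers \<open>e\<^bsup>w\<^sub>2lt\<^esup>\<close>, \<open>l < w\<^sub>1\<close>, equals
  \<open>(e\<^bsup>w\<^sub>1w\<^sub>2t\<^esup> + 1) / (e\<^bsup>w\<^sub>2t\<^esup> + 1)\<close>. This series is symmetric in \<open>w\<^sub>1\<close> and \<open>w\<^sub>2\<close>.\<close>

lemma fps_exp_plus_1_nonzero: "fps_exp c + 1 \<noteq> (0 :: 'a::field_char_0 fps)"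
proof
  assume "fps_exp c + 1 = (0 :: 'a fps)"
  then have "fps_nth (fps_exp c + 1 :: 'a fps) 0 = 0"
    by simp
  then show False
    by simp
qed

text \<open>Substitute \<open>c * t\<close> for \<open>t\<close> in the generating function, that
  is, compose with \<open>?X\<close>. Clearing the denominator first leaves only sums and products
  to compose.\<close>

lemma poly_euler_poly_generating_scaled:
  fixes c y :: "'a::field_char_0"
  shows "Abs_fps (\<lambda>n. c ^ n * poly (euler_poly n) y / fact n) * (fps_exp c + 1)
    = 2 * fps_exp (c * y)"
proof -
  let ?E = "Abs_fps (\<lambda>n. poly (euler_poly n) y / fact n)"
  let ?X = "fps_const c * fps_X"
  have "?E * (fps_exp 1 + 1) = 2 * fps_exp y"
    unfolding poly_euler_poly_generating
    by (simp add: fps_divide_unit mult.assoc inverse_mult_eq_1)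
  then have "(?E * (fps_exp 1 + 1)) oo ?X = (2 * fps_exp y) oo ?X"
    by simp
  then have "(?E oo ?X) * (fps_exp c + 1) = 2 * fps_exp (c * y)"
    by (simp add: fps_compose_mult_distrib fps_compose_add_distrib)
  moreover have "?E oo ?X = Abs_fps (\<lambda>n. c ^ n * poly (euler_poly n) y / fact n)"
    by (rule fps_ext) simp
  ultimately show ?thesis
    by simp
qed

text \<open>A geometric sum of ratio \<open>- q\<close>; oddness of \<open>m\<close> turns
  \<open>1 - (- q) ^ m\<close> into \<open>1 + q ^ m\<close>.\<close>

lemma alternating_geometric_sum_odd:
  fixes q :: "'a::comm_ring_1"
  assumes "odd m"
  shows "(\<Sum>l<m. (-1) ^ l * q ^ l) * (q + 1) = q ^ m + 1"
proof -
  have "(-1) ^ l * q ^ l = (- q) ^ l" for l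
    by (simp only: power_mult_distrib [symmetric] mult_minus1)
  then show ?thesis
    using one_diff_power_eq [of "- q" m] assms by (simp add: mult.commute add.commute)
qed

lemma alternating_euler_sum_generating:
  fixes x :: "'a::field_char_0" and w1 w2 :: nat
  assumes "odd w1"
  shows "Abs_fps (\<lambda>n. of_nat w1 ^ n * (\<Sum>l<w1. (-1) ^ l *
             poly (euler_poly n) (of_nat w2 * x + of_nat w2 / of_nat w1 * of_nat l)) / fact n)
           * ((fps_exp (of_nat w1) + 1) * (fps_exp (of_nat w2) + 1))
       = 2 * fps_exp (of_nat w1 * of_nat w2 * x) * (fps_exp (of_nat w1 * of_nat w2) + 1)"
proof -
  define G where "G y = Abs_fps (\<lambda>n. of_nat w1 ^ n * poly (euler_poly n) y / fact n)" for y :: 'a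
  define y where "y l = of_nat w2 * x + of_nat w2 / of_nat w1 * of_nat l" for l :: nat
  let ?e1 = "fps_exp (of_nat w1) + 1 :: 'a fps"
  let ?e2 = "fps_exp (of_nat w2) :: 'a fps"
  let ?ex = "fps_exp (of_nat w1 * of_nat w2 * x) :: 'a fps"
  have "w1 \<noteq> 0"
    using assms by (metis even_zero)
  \<comment> \<open>The sign is a power series on the left and a scalar on the right.\<close>
  have sgn: "fps_nth ((-1) ^ l * f) n = (-1) ^ l * fps_nth f n" for l n and f :: "'a fps"
    by (cases "even l") simp_all
  have "Abs_fps (\<lambda>n. of_nat w1 ^ n * (\<Sum>l<w1. (-1) ^ l * poly (euler_poly n) (y l)) / fact n)
      = (\<Sum>l<w1. (-1) ^ l * G (y l))"
    by (rule fps_ext)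
      (simp add: G_def fps_sum_nth sgn sum_distrib_left sum_divide_distrib mult_ac)
  moreover have "G (y l) * ?e1 = 2 * ?ex * ?e2 ^ l" for l
  proof -
    \<comment> \<open>Scaling by \<open>w1\<close> clears the denominator in \<open>y l\<close>, so
      the exponential splits into \<open>?ex\<close> and the \<open>l\<close>-th power of
      \<open>?e2\<close>.\<close>
    have "of_nat w1 * y l = of_nat w1 * of_nat w2 * x + of_nat l * of_nat w2"
      using \<open>w1 \<noteq> 0\<close> by (simp add: y_def field_simps)
    then show ?thesis
      unfolding G_def poly_euler_poly_generating_scaled
      by (simp add: fps_exp_add_mult fps_exp_power_mult)
  qed
  then have "(\<Sum>l<w1. (-1) ^ l * G (y l)) * ?e1 = 2 * ?ex * (\<Sum>l<w1. (-1) ^ l * ?e2 ^ l)"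
    by (simp add: sum_distrib_left sum_distrib_right mult.assoc mult.left_commute)
  moreover have geom: "(\<Sum>l<w1. (-1) ^ l * ?e2 ^ l) * (?e2 + 1) = fps_exp (of_nat w1 * of_nat w2) + 1"
    using alternating_geometric_sum_odd [OF assms, of ?e2] by (simp add: fps_exp_power_mult)
  ultimately show ?thesis
    unfolding y_def by (simp only: mult.assoc [symmetric]) (simp only: mult.assoc)
qed

theorem theorem7:
  fixes w1 w2 n :: nat
  assumes "odd w1" and "odd w2"
  shows "of_nat w1 ^ n * (\<Sum>l<w1. (-1) ^ l *
           pcompose (euler_poly n :: 'a::field_char_0 poly)
             [:of_nat w2 / of_nat w1 * of_nat l, of_nat w2:])
       = of_nat w2 ^ n * (\<Sum>l<w2. (-1) ^ l *
           pcompose (euler_poly n)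
             [:of_nat w1 / of_nat w2 * of_nat l, of_nat w1:])"
proof -
  define S :: "nat \<Rightarrow> nat \<Rightarrow> 'a \<Rightarrow> 'a fps" where
    "S u v x = Abs_fps (\<lambda>n. of_nat u ^ n * (\<Sum>l<u. (-1) ^ l *
       poly (euler_poly n) (of_nat v * x + of_nat v / of_nat u * of_nat l)) / fact n)" for u v x
  have "S w1 w2 x = S w2 w1 x" for x
  proof -
    let ?d = "(fps_exp (of_nat w1) + 1) * (fps_exp (of_nat w2) + 1) :: 'a fps"
    have "S w1 w2 x * ?d = S w2 w1 x * ?d"
      using alternating_euler_sum_generating [OF assms(1), of w2 x]
        alternating_euler_sum_generating [OF assms(2), of w1 x]
      by (simp add: S_def mult.commute)
    \<comment> \<open>Power series over a field form an integral domain, so \<open>?d\<close>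
      cancels.\<close>
    moreover have "?d \<noteq> 0"
      by (simp add: fps_exp_plus_1_nonzero)
    ultimately show ?thesis
      by simp
  qed
  then have "fps_nth (S w1 w2 x) n = fps_nth (S w2 w1 x) n" for x
    by simp
  \<comment> \<open>Over an infinite field, polynomials that agree at every point are equal; the
    common \<open>fact n\<close> cancels.\<close>
  then show ?thesis
    by (intro poly_eq_poly_eq_iff [THEN iffD1] ext)
      (simp add: S_def poly_pcompose poly_sum add.commute mult.commute)
qed

end
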